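(* Let $(F,<)$ be a Cauchy complete totally ordered field and $(x_n)$ a positive and decreasing sequence in $F$. Then $\sum_{i=1}^{+\infty}x_i$ is convergent in $F$ if and only if $\sum_{i=0}^{+\infty}2^i x_{2^i}$ is convergent in $F$.
   Context: Put $|x|=\max\{x,-x\}$ for $x\in F$. A sequence $(x_n)$ in $F$ converges to $a\in F$ if for every $\epsilon>0$ in $F$ there is a natural number $N$ such that $n\geq N$ implies $|x_n-a|<\epsilon$; it is Cauchy if for every $\epsilon>0$ in $F$ there is $N$ such that $m,n\geq N$ implies $|x_n-x_m|<\epsilon$. $F$ is Cauchy complete if each Cauchy sequence in $F$ converges to an element of $F$. A series converges if its sequence of partial sums converges. Positive means $x_n>0$ for all $n$; decreasing means $x_{n+1}\leq x_n$ for all $n$. *)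

theory Defs
  imports Main
begin

text \<open>
  Convergence is with respect to the order of an ordered field \<open>F\<close>: the tolerance \<open>\<epsilon>\<close> ranges over
  the positive elements of \<open>F\<close> itself, which need not be Archimedean. In the class
  \<open>linordered_field\<close>, \<open>\<bar>x\<bar>\<close> is the larger of \<open>x\<close> and \<open>- x\<close>.
\<close>

definition converges_to :: "(nat \<Rightarrow> 'a::linordered_field) \<Rightarrow> 'a \<Rightarrow> bool" where
  "converges_to x a \<longleftrightarrow> (\<forall>\<epsilon>>0. \<exists>N. \<forall>n\<ge>N. \<bar>x n - a\<bar> < \<epsilon>)"

definition cauchy_seq :: "(nat \<Rightarrow> 'a::linordered_field) \<Rightarrow> bool" where
  "cauchy_seq x \<longleftrightarrow> (\<forall>\<epsilon>>0. \<exists>N. \<forall>m\<ge>N. \<forall>n\<ge>N. \<bar>x n - x m\<bar> < \<epsilon>)"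

definition cauchy_complete :: "'a::linordered_field itself \<Rightarrow> bool" where
  "cauchy_complete _ \<longleftrightarrow> (\<forall>x :: nat \<Rightarrow> 'a. cauchy_seq x \<longrightarrow> (\<exists>a. converges_to x a))"

text \<open>
  The series \<open>a k + a (k + 1) + \<dots>\<close>, with first index \<open>k\<close>. The partial sums with \<open>n < k\<close> are empty,
  hence \<open>0\<close>; these finitely many leading terms do not affect convergence.
\<close>

definition series_converges_from :: "nat \<Rightarrow> (nat \<Rightarrow> 'a::linordered_field) \<Rightarrow> bool" where
  "series_converges_from k a \<longleftrightarrow> (\<exists>s. converges_to (\<lambda>n. \<Sum>i=k..n. a i) s)"

end

theory Submission
  imports Defs
begin

text \<open>
  Cauchy completeness turns convergence of a series into the statement that its blocks
  \<open>a m + \<dots> + a (n - 1)\<close> are eventually smaller than every positive \<open>\<epsilon>\<close>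
  (\<open>series_converges_from_iff_blocks_small\<close>). This is compared for the two series by
  Cauchy's dyadic grouping: on \<open>2 ^ i \<le> j < 2 ^ Suc i\<close> the \<open>2 ^ i\<close> terms \<open>x j\<close> lie between
  \<open>x (2 ^ Suc i)\<close> and \<open>x (2 ^ i)\<close>, so their sum is at most the condensed term with index \<open>i\<close> and
  at least half of the condensed term with index \<open>Suc i\<close>. Hence blocks of either series are
  dominated by blocks of the other, up to the factor \<open>2\<close>.

  The comparison of blocks, rather than of partial sums, is essential here. In a
  non-Archimedean field a bounded increasing sequence need not converge, even if the field is
  Cauchy complete, so the usual argument through bounded partial sums is unavailable.
\<close>

lemma sum_block_eq_diff:
  fixes a :: "nat \<Rightarrow> 'a::ab_group_add"
  assumes "k \<le> m" "m \<le> n"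
  shows "(\<Sum>i=Suc m..<Suc n. a i) = (\<Sum>i=k..n. a i) - (\<Sum>i=k..m. a i)"
proof -
  have "(\<Sum>i=k..<Suc m. a i) + (\<Sum>i=Suc m..<Suc n. a i) = (\<Sum>i=k..<Suc n. a i)"
    using assms by (intro sum.atLeastLessThan_concat) auto
  then show ?thesis
    unfolding atLeastLessThanSuc_atLeastAtMost by (simp add: algebra_simps)
qed

lemma series_converges_imp_blocks_small:
  fixes a :: "nat \<Rightarrow> 'a::linordered_field"
  assumes "series_converges_from k a" and "\<epsilon> > 0"
  shows "\<exists>N. \<forall>m\<ge>N. \<forall>n\<ge>m. \<bar>\<Sum>i=m..<n. a i\<bar> < \<epsilon>"
proof -
  obtain s where "converges_to (\<lambda>n. \<Sum>i=k..n. a i) s"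
    using assms(1) unfolding series_converges_from_def by blast
  moreover have "\<epsilon> / 2 > 0" using assms(2) by simp
  ultimately obtain N where N: "\<And>n. n \<ge> N \<Longrightarrow> \<bar>(\<Sum>i=k..n. a i) - s\<bar> < \<epsilon> / 2"
    unfolding converges_to_def by blast
  have "\<bar>\<Sum>i=m..<n. a i\<bar> < \<epsilon>" if m: "m \<ge> Suc (max N k)" and n: "n \<ge> m" for m n
  proof -
    obtain m' where m': "m = Suc m'" using m by (cases m) auto
    obtain n' where n': "n = Suc n'" using n m' by (cases n) auto
    have ge: "m' \<ge> N" "m' \<ge> k" "n' \<ge> m'" using m n m' n' by auto
    have "\<bar>(\<Sum>i=k..m'. a i) - s\<bar> < \<epsilon> / 2" "\<bar>(\<Sum>i=k..n'. a i) - s\<bar> < \<epsilon> / 2"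
      using N[of m'] N[of n'] ge by auto
    then have "\<bar>(\<Sum>i=k..n'. a i) - (\<Sum>i=k..m'. a i)\<bar> < \<epsilon>"
      by (simp only: abs_less_iff) (simp add: field_simps; linarith)
    then show ?thesis
      unfolding m' n' using sum_block_eq_diff[OF ge(2,3), of a] by simp
  qed
  then show ?thesis by blast
qed

text \<open>
  Smallness of the blocks is the Cauchy property of the partial sums, whatever the first index
  \<open>k\<close> is: beyond \<open>k\<close>, differences of partial sums are blocks and do not see \<open>k\<close>.
\<close>

lemma blocks_small_imp_series_converges:
  fixes a :: "nat \<Rightarrow> 'a::linordered_field"
  assumes complete: "cauchy_complete TYPE('a)"
    and small: "\<And>\<epsilon>. \<epsilon> > 0 \<Longrightarrow> \<exists>N. \<forall>m\<ge>N. \<forall>n\<ge>m. \<bar>\<Sum>i=m..<n. a i\<bar> < \<epsilon>"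
  shows "series_converges_from k a"
proof -
  let ?S = "\<lambda>n. \<Sum>i=k..n. a i"
  have "\<exists>N. \<forall>m\<ge>N. \<forall>n\<ge>N. \<bar>?S n - ?S m\<bar> < \<epsilon>" if pos: "\<epsilon> > 0" for \<epsilon>
  proof -
    obtain N where N: "\<And>m n. m \<ge> N \<Longrightarrow> n \<ge> m \<Longrightarrow> \<bar>\<Sum>i=m..<n. a i\<bar> < \<epsilon>"
      using small[OF pos] by blast
    have ordered: "\<bar>?S n - ?S m\<bar> < \<epsilon>" if "m \<ge> max N k" "n \<ge> m" for m n
      using N[of "Suc m" "Suc n"] sum_block_eq_diff[of k m n a] that by simp
    have "\<bar>?S n - ?S m\<bar> < \<epsilon>" if "m \<ge> max N k" "n \<ge> max N k" for m n
      using ordered[of m n] ordered[of n m] that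
      by (cases "m \<le> n") (auto simp: abs_minus_commute)
    then show ?thesis by blast
  qed
  then have "cauchy_seq ?S" unfolding cauchy_seq_def by blast
  then show ?thesis
    using complete unfolding cauchy_complete_def series_converges_from_def by blast
qed

lemma series_converges_from_iff_blocks_small:
  fixes a :: "nat \<Rightarrow> 'a::linordered_field"
  assumes "cauchy_complete TYPE('a)"
  shows "series_converges_from k a \<longleftrightarrow>
    (\<forall>\<epsilon>>0. \<exists>N. \<forall>m\<ge>N. \<forall>n\<ge>m. \<bar>\<Sum>i=m..<n. a i\<bar> < \<epsilon>)"
  using series_converges_imp_blocks_small blocks_small_imp_series_converges[OF assms] by blast

lemma sum_dyadic_blocks:
  fixes x :: "nat \<Rightarrow> 'a::comm_monoid_add"
  assumes "m \<le> n"
  shows "(\<Sum>j=2^m..<2^n. x j) = (\<Sum>i=m..<n. \<Sum>j=2^i..<2^Suc i. x j)"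
  using assms
proof (induction rule: dec_induct)
  case (step n)
  have "(\<Sum>j=2^m..<2^n. x j) + (\<Sum>j=2^n..<2^Suc n. x j) = (\<Sum>j=2^m..<2^Suc n. x j)"
    using step.hyps by (intro sum.atLeastLessThan_concat power_increasing) auto
  then show ?case using step by (simp del: power_Suc)
qed simp

lemma dyadic_block_le:
  fixes x :: "nat \<Rightarrow> 'a::linordered_field"
  assumes antimono: "\<And>i j. 1 \<le> i \<Longrightarrow> i \<le> j \<Longrightarrow> x j \<le> x i"
  shows "(\<Sum>j=2^i..<2^Suc i. x j) \<le> 2 ^ i * x (2 ^ i)"
proof -
  have "(\<Sum>j=2^i..<2^Suc i. x j) \<le> (\<Sum>j=2^i..<(2::nat)^Suc i. x (2 ^ i))"
    by (intro sum_mono antimono) auto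
  then show ?thesis by simp
qed

lemma dyadic_block_ge:
  fixes x :: "nat \<Rightarrow> 'a::linordered_field"
  assumes antimono: "\<And>i j. 1 \<le> i \<Longrightarrow> i \<le> j \<Longrightarrow> x j \<le> x i"
  shows "2 ^ Suc i * x (2 ^ Suc i) \<le> 2 * (\<Sum>j=2^i..<2^Suc i. x j)"
proof -
  have pos: "1 \<le> j" if "2 ^ i \<le> j" for j :: nat
    using that one_le_power[of "2::nat" i] by linarith
  have "(\<Sum>j=2^i..<(2::nat)^Suc i. x (2 ^ Suc i)) \<le> (\<Sum>j=2^i..<2^Suc i. x j)"
    by (intro sum_mono antimono) (auto intro: pos)
  then show ?thesis by simp
qed

theorem corollary3p8:
  fixes x :: "nat \<Rightarrow> 'a::linordered_field"
  assumes complete: "cauchy_complete TYPE('a)"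
    and positive: "\<And>n. n \<ge> 1 \<Longrightarrow> x n > 0"
    and decreasing: "\<And>n. n \<ge> 1 \<Longrightarrow> x (Suc n) \<le> x n"
  shows "series_converges_from 1 x \<longleftrightarrow> series_converges_from 0 (\<lambda>i. 2 ^ i * x (2 ^ i))"
proof -
  let ?c = "\<lambda>i. 2 ^ i * x (2 ^ i)"
  have antimono: "x j \<le> x i" if "1 \<le> i" "i \<le> j" for i j
    using that(2)
  proof (induction rule: dec_induct)
    case (step n)
    then show ?case using decreasing[of n] that(1) by simp
  qed simp
  have c_nonneg: "?c i \<ge> 0" for i
    using positive[of "2 ^ i"] by simp
  have abs_x: "\<bar>\<Sum>j=m..<n. x j\<bar> = (\<Sum>j=m..<n. x j)" if "m \<ge> 1" for m n
    using that by (intro abs_of_nonneg sum_nonneg less_imp_le[OF positive]) auto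
  have abs_c: "\<bar>\<Sum>i=m..<n. ?c i\<bar> = (\<Sum>i=m..<n. ?c i)" for m n
    by (intro abs_of_nonneg sum_nonneg c_nonneg)
  have "(\<forall>\<epsilon>>0. \<exists>N. \<forall>m\<ge>N. \<forall>n\<ge>m. \<bar>\<Sum>i=m..<n. x i\<bar> < \<epsilon>) \<longleftrightarrow>
        (\<forall>\<epsilon>>0. \<exists>N. \<forall>m\<ge>N. \<forall>n\<ge>m. \<bar>\<Sum>i=m..<n. ?c i\<bar> < \<epsilon>)" (is "?X \<longleftrightarrow> ?C")
  proof (intro iffI allI impI)
    fix \<epsilon> :: 'a assume "?X" "\<epsilon> > 0"
    moreover from this have "\<epsilon> / 2 > 0" by simp
    ultimately obtain N where
      N: "\<And>m n. m \<ge> N \<Longrightarrow> n \<ge> m \<Longrightarrow> \<bar>\<Sum>i=m..<n. x i\<bar> < \<epsilon> / 2"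
      by blast
    have "\<bar>\<Sum>i=m..<n. ?c i\<bar> < \<epsilon>" if m: "m \<ge> Suc N" and n: "n \<ge> m" for m n
    proof -
      \<comment> \<open>The condensed term with index \<open>i\<close> is bounded by the dyadic block with index \<open>i - 1\<close>.\<close>
      obtain m' where m': "m = Suc m'" using m by (cases m) auto
      obtain n' where n': "n = Suc n'" using n m' by (cases n) auto
      have le: "m' \<le> n'" "N \<le> m'" using m n m' n' by auto
      have N_le: "N \<le> 2 ^ m'"
        using le(2) less_exp[of m'] by linarith
      have "(\<Sum>i=m..<n. ?c i) = (\<Sum>i=m'..<n'. ?c (Suc i))"
        unfolding m' n' by (rule sum.shift_bounds_Suc_ivl)
      also have "\<dots> \<le> (\<Sum>i=m'..<n'. 2 * (\<Sum>j=2^i..<2^Suc i. x j))"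
        by (intro sum_mono dyadic_block_ge antimono)
      also have "\<dots> = 2 * (\<Sum>j=2^m'..<2^n'. x j)"
        by (simp only: sum_dyadic_blocks[OF le(1)] sum_distrib_left)
      also have "\<dots> < \<epsilon>"
        using N[OF N_le, of "2 ^ n'"] le(1) by (simp add: abs_x field_simps)
      finally show ?thesis by (simp only: abs_c)
    qed
    then show "\<exists>N. \<forall>m\<ge>N. \<forall>n\<ge>m. \<bar>\<Sum>i=m..<n. ?c i\<bar> < \<epsilon>" by blast
  next
    fix \<epsilon> :: 'a assume "?C" "\<epsilon> > 0"
    then obtain M where M: "\<And>m n. m \<ge> M \<Longrightarrow> n \<ge> m \<Longrightarrow> \<bar>\<Sum>i=m..<n. ?c i\<bar> < \<epsilon>"
      by blast
    have "\<bar>\<Sum>i=m..<n. x i\<bar> < \<epsilon>" if m: "m \<ge> 2 ^ M" and n: "n \<ge> m" for m n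
    proof -
      \<comment> \<open>As \<open>M < 2 ^ M\<close> and \<open>n < 2 ^ n\<close>, the block lies inside the dyadic range from \<open>2 ^ M\<close>
        to \<open>2 ^ n\<close>; extending it to that range adds only positive terms.\<close>
      have M_le: "M \<le> n" using less_exp[of M] m n by linarith
      have m_pos: "m \<ge> 1" using m one_le_power[of "2::nat" M] by linarith
      have pos: "j \<ge> 1" if "j \<ge> 2 ^ M" for j :: nat
        using that one_le_power[of "2::nat" M] by linarith
      have "(\<Sum>j=m..<n. x j) \<le> (\<Sum>j=2^M..<2^n. x j)"
      proof (rule sum_mono2)
        show "{m..<n} \<subseteq> {2 ^ M..<2 ^ n}" using m less_exp[of n] by auto
      qed (auto intro: less_imp_le[OF positive] pos)
      also have "\<dots> \<le> (\<Sum>i=M..<n. ?c i)"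
        unfolding sum_dyadic_blocks[OF M_le] by (intro sum_mono dyadic_block_le antimono)
      also have "\<dots> < \<epsilon>" using M[of M n] M_le by (simp add: abs_c)
      finally show ?thesis by (simp only: abs_x[OF m_pos])
    qed
    then show "\<exists>N. \<forall>m\<ge>N. \<forall>n\<ge>m. \<bar>\<Sum>i=m..<n. x i\<bar> < \<epsilon>" by blast
  qed
  then show ?thesis
    by (simp only: series_converges_from_iff_blocks_small[OF complete])
qed

end
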